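(* Let $G$ be a connected $7$-regular graph with $\tau(G)>2\nu(G)$, and let $uv\in E(G)$ be an edge with exactly five common neighbours, i.e. $|N(u)\cap N(v)|=5$. Then the vertex set $\{u,v\}$ is reducible in $G$.
   Context: All graphs are finite, simple and undirected; $N(x)$ is the open neighbourhood of $x$. $\nu(G)$ is the maximum number of pairwise edge-disjoint triangles of $G$, and $\tau(G)$ is the minimum size of a set $Y\subseteq E(G)$ such that $G-Y$ is triangle-free. For a set $S$ of triangles, an $S$-edge is an edge of some triangle in $S$. A nonempty set $V_0\subseteq V(G)$ is reducible (in $G$) if there exist a set $S$ of pairwise edge-disjoint triangles in $G$ and a set $X$ of edges of $G$ such that: (i) $|X|\le 2|S|$; (ii) $G-X$ (the graph $G$ with the edges of $X$ deleted) has no triangle containing a vertex of $V_0$; and (iii) $X$ contains every $S$-edge whose endpoints are both outside $V_0$. *)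

theory Defs
  imports "HOL-Library.Ramsey"
begin

text \<open>
  A graph is given by a vertex set V and a set E of two-element subsets of V;
  nsets A k (from Ramsey) is the set of k-element subsets of A.
\<close>

definition simple_graph :: "'a set \<Rightarrow> 'a set set \<Rightarrow> bool" where
  "simple_graph V E \<longleftrightarrow> finite V \<and> E \<subseteq> nsets V 2"

definition nbhd :: "'a set set \<Rightarrow> 'a \<Rightarrow> 'a set" where
  "nbhd E x = {y. {x, y} \<in> E}"

definition regular_graph :: "nat \<Rightarrow> 'a set \<Rightarrow> 'a set set \<Rightarrow> bool" where
  "regular_graph k V E \<longleftrightarrow> (\<forall>x\<in>V. card (nbhd E x) = k)"

definition connected_graph :: "'a set \<Rightarrow> 'a set set \<Rightarrow> bool" where
  "connected_graph V E \<longleftrightarrow>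
     V \<noteq> {} \<and> (\<forall>x\<in>V. \<forall>y\<in>V. (x, y) \<in> {(a, b). {a, b} \<in> E}\<^sup>*)"

text \<open>A triangle is identified with its vertex set T; its edges are then the members of nsets T 2.\<close>

definition triangles :: "'a set \<Rightarrow> 'a set set \<Rightarrow> 'a set set" where
  "triangles V E = {T \<in> nsets V 3. nsets T 2 \<subseteq> E}"

definition triangle_packing :: "'a set \<Rightarrow> 'a set set \<Rightarrow> 'a set set \<Rightarrow> bool" where
  "triangle_packing V E S \<longleftrightarrow>
     S \<subseteq> triangles V E \<and> pairwise (\<lambda>T T'. nsets T 2 \<inter> nsets T' 2 = {}) S"

definition \<nu> :: "'a set \<Rightarrow> 'a set set \<Rightarrow> nat" where
  "\<nu> V E = Max (card ` {S. triangle_packing V E S})"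

definition \<tau> :: "'a set \<Rightarrow> 'a set set \<Rightarrow> nat" where
  "\<tau> V E = Min (card ` {Y. Y \<subseteq> E \<and> triangles V (E - Y) = {}})"

definition S_edges :: "'a set set \<Rightarrow> 'a set set" where
  "S_edges S = (\<Union>T\<in>S. nsets T 2)"

definition reducible :: "'a set \<Rightarrow> 'a set set \<Rightarrow> 'a set \<Rightarrow> bool" where
  "reducible V E V0 \<longleftrightarrow>
     V0 \<noteq> {} \<and> V0 \<subseteq> V \<and>
     (\<exists>S X. triangle_packing V E S \<and> X \<subseteq> E \<and>
        card X \<le> 2 * card S \<and>
        (\<forall>T\<in>triangles V (E - X). T \<inter> V0 = {}) \<and>
        (\<forall>e\<in>S_edges S. e \<inter> V0 = {} \<longrightarrow> e \<in> X))"

text \<open>The extrema defining \<open>\<nu>\<close> and \<open>\<tau>\<close> are taken over finite nonempty sets.\<close>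

lemma finite_edges:
  assumes "simple_graph V E" shows "finite E"
  using assms unfolding simple_graph_def by (meson finite_imp_finite_nsets finite_subset)

lemma finite_triangles:
  assumes "simple_graph V E" shows "finite (triangles V E)"
  using assms unfolding simple_graph_def triangles_def
  by (simp add: finite_imp_finite_nsets)

lemma packings_finite_nonempty:
  assumes "simple_graph V E"
  shows "finite {S. triangle_packing V E S}" "{S. triangle_packing V E S} \<noteq> {}"
proof -
  have "{S. triangle_packing V E S} \<subseteq> Pow (triangles V E)"
    by (auto simp: triangle_packing_def)
  then show "finite {S. triangle_packing V E S}"
    using finite_triangles[OF assms] by (meson finite_Pow_iff finite_subset)
  have "triangle_packing V E {}" by (simp add: triangle_packing_def)
  then show "{S. triangle_packing V E S} \<noteq> {}" by blast
qed

lemma covers_finite_nonempty: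
  assumes "simple_graph V E"
  shows "finite {Y. Y \<subseteq> E \<and> triangles V (E - Y) = {}}"
    and "{Y. Y \<subseteq> E \<and> triangles V (E - Y) = {}} \<noteq> {}"
proof -
  show "finite {Y. Y \<subseteq> E \<and> triangles V (E - Y) = {}}"
    using finite_edges[OF assms] by simp
  have "nsets T 2 \<noteq> {}" if "T \<in> nsets V 3" for T
    proof -
    have "finite T" "card T = 3" using that by (auto simp: nsets_def)
    then show ?thesis using obtain_subset_with_card_n[of 2 T] by (auto simp: nsets_eq_empty_iff)
  qed
  then have "triangles V (E - E) = {}" by (auto simp: triangles_def)
  then show "{Y. Y \<subseteq> E \<and> triangles V (E - Y) = {}} \<noteq> {}" by blast
qed

end

theory Submission
  imports Defs
begin

text \<open>
  Let \<open>C\<close> be the set of the five common neighbours of \<open>u\<close> and \<open>v\<close>; by regularity \<open>u\<close> and \<open>v\<close>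
  have one further neighbour each, \<open>a\<close> and \<open>b\<close>. A matching in the link of \<open>u\<close>, an edge-disjoint
  matching in the link of \<open>v\<close>, a triangle \<open>uvc\<close> with \<open>c\<close> avoiding both matchings, and triangles
  inside \<open>C\<close> together form a packing. The triangles meeting \<open>{u, v}\<close> are destroyed by deleting
  \<open>uv\<close>, the edges from \<open>u\<close> and \<open>v\<close> to chosen vertices, and the remaining edges of the two links.
  Whether this is cheap enough depends only on the graph \<open>H\<close> induced on \<open>C\<close> and on the neighbours
  of \<open>a\<close> and \<open>b\<close> in \<open>C\<close>. If \<open>H\<close> has no two disjoint edges, it is a star or a triangle; otherwise
  it has disjoint edges \<open>xy\<close>, \<open>zw\<close>, and one distinguishes whether they span \<open>2K\<^sub>2\<close>, a path, a paw,
  or a graph containing a 4-cycle.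
\<close>

section \<open>Edges and triangles as vertex sets\<close>

lemma edge_in_graph:
  assumes "simple_graph V E" "{p, q} \<in> E"
  shows "p \<in> V" "q \<in> V" "p \<noteq> q"
  using assms unfolding simple_graph_def nsets_def by (auto simp: card_insert_if split: if_splits)

lemma edgeE:
  assumes "simple_graph V E" "e \<in> E"
  obtains p q where "e = {p, q}" "p \<noteq> q"
  using assms unfolding simple_graph_def nsets_def by (auto simp: card_2_iff)

lemma nsets_triple:
  assumes "p \<noteq> q" "p \<noteq> r" "q \<noteq> r"
  shows "nsets {p, q, r} 2 = {{p, q}, {p, r}, {q, r}}"
  using assms by (auto simp: nsets_def card_2_iff)

lemma nsets_2_insert:
  assumes "p \<notin> A"
  shows "nsets (insert p A) 2 = nsets A 2 \<union> (\<lambda>q. {p, q}) ` A"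
  using assms by (auto simp: nsets_def card_2_iff doubleton_eq_iff)

lemma triangleI:
  assumes "simple_graph V E" "{p, q} \<in> E" "{p, r} \<in> E" "{q, r} \<in> E"
  shows "{p, q, r} \<in> triangles V E"
proof -
  note edge_in_graph[OF assms(1)]
  then have "p \<noteq> q" "p \<noteq> r" "q \<noteq> r" "{p, q, r} \<subseteq> V"
    using assms(2-4) by blast+
  then show ?thesis
    using assms(2-4) by (auto simp: triangles_def nsets_triple) (auto simp: nsets_def)
qed

lemma triangle_edge:
  assumes "T \<in> triangles V E" "p \<in> T" "q \<in> T" "p \<noteq> q"
  shows "{p, q} \<in> E"
proof -
  have "{p, q} \<in> nsets T 2"
    using assms by (auto simp: nsets_def)
  then show ?thesis
    using assms(1) by (auto simp: triangles_def)
qed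

lemma triangleE:
  assumes "T \<in> triangles V E" "p \<in> T"
  obtains q r where "T = {p, q, r}" "p \<noteq> q" "p \<noteq> r" "q \<noteq> r"
proof -
  have "card T = 3" "finite T" using assms by (auto simp: triangles_def nsets_def)
  then have "card (T - {p}) = 2" using assms by simp
  then obtain q r where "T - {p} = {q, r}" "q \<noteq> r" by (auto simp: card_2_iff)
  then show thesis using that[of q r] assms(2) by blast
qed

section \<open>Reducing an edge by matchings in the two links\<close>

lemma edge_disjointI:
  assumes "\<And>p q. p \<in> T \<Longrightarrow> q \<in> T \<Longrightarrow> p \<in> T' \<Longrightarrow> q \<in> T' \<Longrightarrow> p = q"
  shows "nsets T 2 \<inter> nsets T' 2 = {}"
  using assms by (fastforce simp: nsets_def card_2_iff)

text \<open>The packing consists of \<open>uvc\<close>, the triangles joining \<open>u\<close> to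
  the edges of \<open>P\<close> and \<open>v\<close> to those of \<open>Q\<close>, and
  \<open>R\<close>. Deleted are \<open>uv\<close>, the edges from \<open>u\<close> to
  \<open>Wu\<close> and from \<open>v\<close> to \<open>Wv\<close>, and \<open>F\<close>. A
  surviving triangle at \<open>u\<close> would avoid \<open>v\<close> and \<open>Wu\<close>, so its
  edge opposite \<open>u\<close> would lie in \<open>F\<close> by \<open>coveru\<close>; likewise at
  \<open>v\<close>. The packing edges away from \<open>u\<close> and \<open>v\<close> lie in
  \<open>F\<close>, and \<open>size\<close> bounds the deletions by twice the packing.\<close>

lemma reducible_edgeI:
  assumes G: "simple_graph V E" and uv: "{u, v} \<in> E"
    and c: "c \<in> nbhd E u" "c \<in> nbhd E v"
    and P: "P \<subseteq> E" "pairwise disjnt P" "\<Union>P \<subseteq> nbhd E u - {v, c}"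
    and Q: "Q \<subseteq> E" "pairwise disjnt Q" "\<Union>Q \<subseteq> nbhd E v - {u, c}"
    and PQ: "P \<inter> Q = {}"
    and R: "triangle_packing V E R" "\<Union>R \<inter> {u, v} = {}" "S_edges R \<inter> (P \<union> Q) = {}"
    and F: "finite F" "P \<union> Q \<union> S_edges R \<subseteq> F"
    and W: "finite Wu" "finite Wv"
    and coveru: "E \<inter> nsets (nbhd E u - {v} - Wu) 2 \<subseteq> F"
    and coverv: "E \<inter> nsets (nbhd E v - {u} - Wv) 2 \<subseteq> F"
    and size: "1 + card Wu + card Wv + card F \<le> 2 * (1 + card P + card Q + card R)"
  shows "reducible V E {u, v}"
proof -
  note edge = edge_in_graph[OF G]
  define S where "S = insert {u, v, c} (insert u ` P \<union> insert v ` Q \<union> R)"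
  \<comment> \<open>\<open>F\<close>, \<open>Wu\<close> and \<open>Wv\<close> may name pairs that
    are not edges of the graph, hence the intersection with \<open>E\<close>.\<close>
  define X where "X = (insert {u, v} ((\<lambda>s. {u, s}) ` Wu \<union> (\<lambda>s. {v, s}) ` Wv \<union> F)) \<inter> E"
  have Eu: "{u, p} \<in> E" if "p \<in> nbhd E u" for p using that by (simp add: nbhd_def)
  have Ev: "{v, p} \<in> E" if "p \<in> nbhd E v" for p using that by (simp add: nbhd_def)
  have ne: "u \<noteq> v" "c \<noteq> u" "c \<noteq> v" using edge(3) uv Eu Ev c by blast+
  have uP: "u \<notin> e" "v \<notin> e" "c \<notin> e" if "e \<in> P" for e
    using that P(3) Eu edge(3) by blast+
  have vQ: "u \<notin> e" "v \<notin> e" "c \<notin> e" if "e \<in> Q" for e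
    using that Q(3) Ev edge(3) by blast+
  have PE: "\<exists>p q. e = {p, q} \<and> p \<noteq> q" if "e \<in> P \<union> Q" for e
    using that P(1) Q(1) edgeE[OF G] by (metis Un_iff subsetD)
  have RT: "R \<subseteq> triangles V E" "\<And>T. T \<in> R \<Longrightarrow> u \<notin> T \<and> v \<notin> T"
    using R by (auto simp: triangle_packing_def)
  have tri: "S \<subseteq> triangles V E"
  proof -
    have "{u, v, c} \<in> triangles V E" using triangleI[OF G uv] Eu Ev c by blast
    moreover have "insert u e \<in> triangles V E" if "e \<in> P" for e
    proof -
      obtain p q where "e = {p, q}" using PE \<open>e \<in> P\<close> by blast
      then show ?thesis using that P Eu triangleI[OF G, of u p q] by blast
    qed
    moreover have "insert v e \<in> triangles V E" if "e \<in> Q" for e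
    proof -
      obtain p q where "e = {p, q}" using PE \<open>e \<in> Q\<close> by blast
      then show ?thesis using that Q Ev triangleI[OF G, of v p q] by blast
    qed
    ultimately show ?thesis using RT by (auto simp: S_def)
  qed
  \<comment> \<open>Two vertices determine an edge, so distinct edges share at most one
    vertex.\<close>
  have small: "p = q" if "e \<in> P \<union> Q" "f \<in> P \<union> Q" "e \<noteq> f" "p \<in> e" "q \<in> e" "p \<in> f" "q \<in> f" for e f p q
    using PE[OF that(1)] PE[OF that(2)] that by blast
  have smallR: "p = q" if "e \<in> P \<union> Q" "T \<in> R" "p \<in> e" "q \<in> e" "p \<in> T" "q \<in> T" for e T p q
  proof (rule ccontr)
    assume "p \<noteq> q"
    then have "e = {p, q}" using PE[OF that(1)] that by blast
    then have "e \<in> nsets T 2" using that \<open>p \<noteq> q\<close> by (auto simp: nsets_def)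
    then show False using R(3) that by (auto simp: S_edges_def)
  qed
  define dj where "dj T T' \<longleftrightarrow> nsets T 2 \<inter> nsets T' 2 = {}" for T T' :: "'a set"
  have djc: "dj T T' \<Longrightarrow> dj T' T" for T T' by (auto simp: dj_def)
  have d1: "dj {u, v, c} (insert u e)" if "e \<in> P" for e
    unfolding dj_def using uP[OF that] ne by (intro edge_disjointI) blast
  have d2: "dj {u, v, c} (insert v e)" if "e \<in> Q" for e
    unfolding dj_def using vQ[OF that] ne by (intro edge_disjointI) blast
  have d3: "dj {u, v, c} T" if "T \<in> R" for T
    unfolding dj_def using RT(2)[OF that] ne by (intro edge_disjointI) blast
  have d4: "dj (insert u e) (insert u f)" if "e \<in> P" "f \<in> P" "e \<noteq> f" for e f
  proof -
    have "e \<inter> f = {}" using P(2) that by (auto simp: pairwise_def disjnt_def)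
    then show ?thesis unfolding dj_def using uP that by (intro edge_disjointI) blast
  qed
  have d5: "dj (insert v e) (insert v f)" if "e \<in> Q" "f \<in> Q" "e \<noteq> f" for e f
  proof -
    have "e \<inter> f = {}" using Q(2) that by (auto simp: pairwise_def disjnt_def)
    then show ?thesis unfolding dj_def using vQ that by (intro edge_disjointI) blast
  qed
  \<comment> \<open>\<open>P\<close> and \<open>Q\<close> may share vertices; sharing no edge is
    enough, because the apices \<open>u\<close> and \<open>v\<close> differ.\<close>
  have d6: "dj (insert u e) (insert v f)" if "e \<in> P" "f \<in> Q" for e f
  proof -
    have "e \<noteq> f" using PQ that by blast
    then show ?thesis unfolding dj_def using uP[OF that(1)] vQ[OF that(2)] small[of e f] that ne
      by (intro edge_disjointI) blast
  qed
  have d7: "dj (insert u e) T" if "e \<in> P" "T \<in> R" for e T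
    unfolding dj_def using RT(2)[OF that(2)] smallR[of e T] that by (intro edge_disjointI) blast
  have d8: "dj (insert v e) T" if "e \<in> Q" "T \<in> R" for e T
    unfolding dj_def using RT(2)[OF that(2)] smallR[of e T] that by (intro edge_disjointI) blast
  have d9: "dj T T'" if "T \<in> R" "T' \<in> R" "T \<noteq> T'" for T T'
    using R(1) that by (auto simp: triangle_packing_def pairwise_def dj_def)
  have "pairwise dj S"
  proof (rule pairwiseI)
    fix T T' assume "T \<in> S" "T' \<in> S" "T \<noteq> T'"
    then show "dj T T'"
      unfolding S_def
      by (elim insertE UnE imageE)
        (auto intro: d1 d2 d3 d4 d5 d6 d7 d8 d9 djc[OF d1] djc[OF d2] djc[OF d3] djc[OF d6] djc[OF d7] djc[OF d8])
  qed
  then have pack: "triangle_packing V E S"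
    using tri by (simp add: triangle_packing_def pairwise_def dj_def)
  have finE: "finite E" by (rule finite_edges[OF G])
  have fin: "finite P" "finite Q" "finite R"
    using P(1) Q(1) finE RT(1) finite_triangles[OF G] by (auto intro: finite_subset)
  have card_S: "card S = 1 + card P + card Q + card R"
  proof -
    have "insert u ` P \<inter> insert v ` Q = {}" using uP vQ ne by blast
    moreover have "(insert u ` P \<union> insert v ` Q) \<inter> R = {}" using RT(2) by blast
    moreover have "{u, v, c} \<notin> insert u ` P \<union> insert v ` Q \<union> R"
      using uP vQ ne RT(2) by blast
    moreover have "inj_on (insert u) P" "inj_on (insert v) Q"
      using uP vQ by (auto intro!: inj_onI simp: insert_ident)
    ultimately show ?thesis
      using fin by (simp add: S_def card_Un_disjoint card_image)
  qed
  have card_X: "card X \<le> 1 + card Wu + card Wv + card F"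
  proof -
    let ?A = "(\<lambda>s. {u, s}) ` Wu" and ?B = "(\<lambda>s. {v, s}) ` Wv"
    have "card X \<le> card (insert {u, v} (?A \<union> ?B \<union> F))"
      unfolding X_def using W F by (intro card_mono) auto
    also have "\<dots> \<le> Suc (card (?A \<union> ?B \<union> F))"
      by (rule card_insert_le_m1[THEN order_trans]) auto
    also have "card (?A \<union> ?B \<union> F) \<le> card ?A + card ?B + card F"
      by (meson add_mono card_Un_le order_refl order_trans)
    also have "card ?A \<le> card Wu" by (rule card_image_le[OF W(1)])
    also have "card ?B \<le> card Wv" by (rule card_image_le[OF W(2)])
    finally show ?thesis by simp
  qed
  from card_X size have "card X \<le> 2 * card S" unfolding card_S by (rule order_trans)
  moreover have "T \<inter> {u, v} = {}" if T: "T \<in> triangles V (E - X)" for T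
  proof -
    have T2: "{p, q} \<in> E" "{p, q} \<notin> X" if "p \<in> T" "q \<in> T" "p \<noteq> q" for p q
      using triangle_edge[OF T that] by auto
    have nuv: "\<not> (u \<in> T \<and> v \<in> T)" using T2[of u v] ne by (auto simp: X_def)
    have "u \<notin> T"
    proof
      assume "u \<in> T"
      then obtain p q where t: "T = {u, p, q}" "u \<noteq> p" "u \<noteq> q" "p \<noteq> q" using triangleE[OF T] by blast
      then have "v \<noteq> p" "v \<noteq> q" using nuv by auto
      moreover have "p \<in> nbhd E u" "q \<in> nbhd E u" using T2 t by (auto simp: nbhd_def)
      moreover have "p \<notin> Wu" "q \<notin> Wu" using T2[of u p] T2[of u q] t by (auto simp: X_def)
      ultimately have "{p, q} \<in> F" using coveru T2(1)[of p q] t by (auto simp: nsets_def)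
      then show False using T2[of p q] t by (auto simp: X_def)
    qed
    moreover have "v \<notin> T"
    proof
      assume "v \<in> T"
      then obtain p q where t: "T = {v, p, q}" "v \<noteq> p" "v \<noteq> q" "p \<noteq> q" using triangleE[OF T] by blast
      then have "u \<noteq> p" "u \<noteq> q" using nuv by auto
      moreover have "p \<in> nbhd E v" "q \<in> nbhd E v" using T2 t by (auto simp: nbhd_def)
      moreover have "p \<notin> Wv" "q \<notin> Wv" using T2[of v p] T2[of v q] t by (auto simp: X_def)
      ultimately have "{p, q} \<in> F" using coverv T2(1)[of p q] t by (auto simp: nsets_def)
      then show False using T2[of p q] t by (auto simp: X_def)
    qed
    ultimately show ?thesis by blast
  qed
  moreover have "e \<in> X" if e: "e \<in> S_edges S" "e \<inter> {u, v} = {}" for e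
  proof -
    obtain T where T: "T \<in> S" "e \<in> nsets T 2" using e(1) by (auto simp: S_edges_def)
    then have eE: "e \<in> E" using tri by (auto simp: triangles_def)
    obtain p q where pq: "e = {p, q}" "p \<noteq> q" using edgeE[OF G eE] .
    then have pT: "p \<in> T" "q \<in> T" "p \<notin> {u, v}" "q \<notin> {u, v}" using T e by (auto simp: nsets_def)
    have "e \<in> F"
      using T(1) unfolding S_def
    proof (elim insertE UnE imageE)
      assume "T = {u, v, c}" then show ?thesis using pT pq by auto
    next
      fix f assume f: "T = insert u f" "f \<in> P"
      then have "e = f" using PE[of f] pT pq by auto
      then show ?thesis using f F by auto
    next
      fix f assume f: "T = insert v f" "f \<in> Q"
      then have "e = f" using PE[of f] pT pq by auto
      then show ?thesis using f F by auto
    next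
      assume "T \<in> R" then show ?thesis using T F by (auto simp: S_edges_def)
    qed
    then show ?thesis using eE by (simp add: X_def)
  qed
  moreover have "X \<subseteq> E" by (simp add: X_def)
  moreover have "u \<in> V" "v \<in> V" using edge[OF uv] by auto
  ultimately show ?thesis
    unfolding reducible_def using pack by blast
qed

text \<open>Lets \<open>simp\<close> check a cover of an enumerated set of pairs one pair at a
  time.\<close>

lemma Int_insert_subset_iff:
  "A \<inter> insert e B \<subseteq> F \<longleftrightarrow> (e \<in> A \<longrightarrow> e \<in> F) \<and> A \<inter> B \<subseteq> F"
  by blast

lemma distinct_5:
  assumes "distinct [c, x, y, z, w]"
  shows "c \<noteq> x" "c \<noteq> y" "c \<noteq> z" "c \<noteq> w" "x \<noteq> y" "x \<noteq> z" "x \<noteq> w" "y \<noteq> z" "y \<noteq> w" "z \<noteq> w"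
    "x \<noteq> c" "y \<noteq> c" "z \<noteq> c" "w \<noteq> c" "y \<noteq> x" "z \<noteq> x" "w \<noteq> x" "z \<noteq> y" "w \<noteq> y" "w \<noteq> z"
  using assms by auto

section \<open>The local picture at an edge with five common neighbours\<close>

locale five_common_nbrs =
  fixes V :: "'a set" and E :: "'a set set" and u v a b :: 'a and C :: "'a set"
  assumes graph: "simple_graph V E"
    and nbhd_u: "nbhd E u = insert v (insert a C)"
    and nbhd_v: "nbhd E v = insert u (insert b C)"
    and card_C: "card C = 5"
    and fresh: "distinct [u, v, a, b]" "{u, v, a, b} \<inter> C = {}"
begin

lemma swap: "five_common_nbrs V E v u b a C"
  using graph nbhd_u nbhd_v card_C fresh by unfold_locales auto

lemma uv: "{u, v} \<in> E"
  using nbhd_u by (auto simp: nbhd_def)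

text \<open>Supplies fresh vertices, in particular the \<open>c\<close> whose triangle
  \<open>uvc\<close> must avoid the matchings.\<close>

lemma other_vertex:
  assumes "length xs < 5"
  obtains c where "c \<in> C" "c \<notin> set xs"
proof -
  have "\<not> C \<subseteq> set xs"
    using card_C assms card_mono[of "set xs" C] card_length[of xs] by auto
  then show thesis using that by blast
qed

text \<open>
  The triangles at the private neighbour \<open>a'\<close> cost nothing if the vertices in \<open>W\<close> already hit them
  all. They also cost nothing if \<open>a'\<close> has a neighbour \<open>s\<close> not yet used: adding \<open>a's\<close> to the matching
  gains a triangle, which pays for deleting \<open>a's\<close> and the edge to \<open>a'\<close>. Otherwise deleting the
  edge to \<open>a'\<close> costs \<open>d = 1\<close>.
\<close>

lemma private_edge_choice:
  assumes "\<Union>P \<subseteq> C - {c}" "a' \<notin> C" "c \<in> C" "pairwise disjnt P"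
    and "nbhd E a' \<inter> C \<subseteq> W \<or> \<not> nbhd E a' \<inter> C \<subseteq> insert c (\<Union>P) \<or> 1 \<le> d"
  obtains P' W' where "P' \<subseteq> E" "finite P'" "pairwise disjnt (P \<union> P')" "\<And>e. e \<in> P' \<Longrightarrow> a' \<in> e"
    "\<Union>P' \<subseteq> insert a' C - {c}" "finite W'" "card W' \<le> card P' + d"
    "W' = {} \<Longrightarrow> nbhd E a' \<inter> C \<subseteq> W" "W' \<noteq> {} \<Longrightarrow> a' \<in> W'"
  using assms(5)
proof (elim disjE)
  assume "nbhd E a' \<inter> C \<subseteq> W"
  then show thesis using assms(4) by (intro that[of "{}" "{}"]) auto
next
  assume "\<not> nbhd E a' \<inter> C \<subseteq> insert c (\<Union>P)"
  then obtain s where s: "{a', s} \<in> E" "s \<in> C" "s \<noteq> c" "s \<notin> \<Union>P" by (auto simp: nbhd_def)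
  moreover have "a' \<noteq> c" "a' \<notin> \<Union>P" using assms by auto
  moreover have "pairwise disjnt (P \<union> {{a', s}})"
    using assms(4) s \<open>a' \<notin> \<Union>P\<close> by (auto simp: pairwise_insert disjnt_iff)
  ultimately show thesis by (intro that[of "{{a', s}}" "{a'}"]) auto
next
  assume "1 \<le> d"
  then show thesis using assms(4) by (intro that[of "{}" "{a'}"]) auto
qed

text \<open>
  \<open>P\<close>, \<open>Q\<close>, \<open>W\<close>, \<open>F\<close> only concern the graph on \<open>C\<close>; \<open>da\<close> and \<open>db\<close> are the prices for \<open>a\<close> and \<open>b\<close>.
\<close>

lemma reducible_coreI:
  assumes c: "c \<in> C" and W: "finite W"
    and P: "P \<subseteq> E" "pairwise disjnt P" "\<Union>P \<subseteq> C - {c}"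
    and Q: "Q \<subseteq> E" "pairwise disjnt Q" "\<Union>Q \<subseteq> C - {c}"
    and PQ: "P \<inter> Q = {}"
    and R: "triangle_packing V E R" "\<Union>R \<subseteq> C" "S_edges R \<inter> (P \<union> Q) = {}"
    and F: "finite F" "P \<union> Q \<union> S_edges R \<subseteq> F"
    and cover: "E \<inter> nsets (C - W) 2 \<subseteq> F"
    and a: "nbhd E a \<inter> C \<subseteq> W \<or> \<not> nbhd E a \<inter> C \<subseteq> insert c (\<Union>P) \<or> 1 \<le> da"
    and b: "nbhd E b \<inter> C \<subseteq> W \<or> \<not> nbhd E b \<inter> C \<subseteq> insert c (\<Union>Q) \<or> 1 \<le> db"
    and size: "1 + 2 * card W + card F + da + db \<le> 2 * (1 + card P + card Q + card R)"
  shows "reducible V E {u, v}"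
proof -
  have aC: "a \<notin> C" and bC: "b \<notin> C" using fresh by auto
  from private_edge_choice[OF P(3) aC c P(2) a] obtain P' Wa
    where P': "P' \<subseteq> E" "finite P'" "pairwise disjnt (P \<union> P')" "\<And>e. e \<in> P' \<Longrightarrow> a \<in> e"
      "\<Union>P' \<subseteq> insert a C - {c}" "finite Wa" "card Wa \<le> card P' + da"
      "Wa = {} \<Longrightarrow> nbhd E a \<inter> C \<subseteq> W" "Wa \<noteq> {} \<Longrightarrow> a \<in> Wa" by metis
  from private_edge_choice[OF Q(3) bC c Q(2) b] obtain Q' Wb
    where Q': "Q' \<subseteq> E" "finite Q'" "pairwise disjnt (Q \<union> Q')" "\<And>e. e \<in> Q' \<Longrightarrow> b \<in> e"
      "\<Union>Q' \<subseteq> insert b C - {c}" "finite Wb" "card Wb \<le> card Q' + db"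
      "Wb = {} \<Longrightarrow> nbhd E b \<inter> C \<subseteq> W" "Wb \<noteq> {} \<Longrightarrow> b \<in> Wb" by metis
  have fin: "finite P" "finite Q"
    using P(1) Q(1) finite_edges[OF graph] by (auto intro: finite_subset)
  have PP': "P \<inter> P' = {}" using P(3) P'(4) aC by blast
  have QQ': "Q \<inter> Q' = {}" using Q(3) Q'(4) bC by blast
  have SR: "e \<subseteq> C" if "e \<in> S_edges R" for e
    using that R(2) by (auto simp: S_edges_def nsets_def)
  \<comment> \<open>If \<open>x\<close> is not in \<open>Wx\<close>, then \<open>Wx\<close> is empty
    and \<open>W\<close> contains every neighbour of \<open>x\<close> in \<open>C\<close>. So in
    either case no edge at \<open>x\<close> remains, and the edge lies inside
    \<open>C - W\<close>.\<close>
  have cover1: "E \<inter> nsets (insert x C - (W \<union> Wx)) 2 \<subseteq> F"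
    if "Wx = {} \<Longrightarrow> nbhd E x \<inter> C \<subseteq> W" "Wx \<noteq> {} \<Longrightarrow> x \<in> Wx" for x Wx
  proof
    fix e assume e: "e \<in> E \<inter> nsets (insert x C - (W \<union> Wx)) 2"
    then obtain p q where pq: "e = {p, q}" "p \<noteq> q" using edgeE[OF graph] by blast
    moreover have "q \<in> W" if "{x, q} \<in> E" "q \<in> C" "x \<notin> Wx" for q
      using that \<open>Wx = {} \<Longrightarrow> nbhd E x \<inter> C \<subseteq> W\<close> \<open>Wx \<noteq> {} \<Longrightarrow> x \<in> Wx\<close> by (auto simp: nbhd_def)
    moreover have e': "{p, q} \<in> E" "p \<in> insert x C - (W \<union> Wx)" "q \<in> insert x C - (W \<union> Wx)"
      using e pq by (auto simp: nsets_def)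
    ultimately have "p \<in> C" "q \<in> C" by (metis DiffE UnCI insertE insert_commute)+
    then have "{p, q} \<in> nsets (C - W) 2" using e' pq by (auto simp: nsets_def)
    then show "e \<in> F" using cover e' pq by blast
  qed
  have "card (W \<union> Wa) \<le> card W + card Wa" "card (W \<union> Wb) \<le> card W + card Wb"
    by (rule card_Un_le)+
  moreover have "card (F \<union> P' \<union> Q') \<le> card F + card P' + card Q'"
    by (meson add_mono card_Un_le order_refl order_trans)
  moreover have "card (P \<union> P') = card P + card P'" "card (Q \<union> Q') = card Q + card Q'"
    using fin P'(2) Q'(2) PP' QQ' by (simp_all add: card_Un_disjoint)
  \<comment> \<open>Each edge of \<open>P'\<close> adds 2 to the right-hand side and pays for itself
    in \<open>F\<close> and for one vertex of \<open>Wa\<close>; only \<open>da\<close> is left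
    over. The same holds for \<open>Q'\<close>, \<open>Wb\<close> and \<open>db\<close>.\<close>
  ultimately have size': "1 + card (W \<union> Wa) + card (W \<union> Wb) + card (F \<union> P' \<union> Q')
      \<le> 2 * (1 + card (P \<union> P') + card (Q \<union> Q') + card R)"
    using size P'(7) Q'(7) by simp
  have "\<Union>(P \<union> P') \<subseteq> insert a C - {c}" "\<Union>(Q \<union> Q') \<subseteq> insert b C - {c}"
    using P(3) P'(5) Q(3) Q'(5) by auto
  then have in_nbhd: "\<Union>(P \<union> P') \<subseteq> nbhd E u - {v, c}" "\<Union>(Q \<union> Q') \<subseteq> nbhd E v - {u, c}"
    using nbhd_u nbhd_v fresh by auto
  have C_u: "nbhd E u - {v} = insert a C" and C_v: "nbhd E v - {u} = insert b C"
    using nbhd_u nbhd_v fresh by auto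
  show ?thesis
  proof (rule reducible_edgeI[OF graph uv _ _ _ P'(3) in_nbhd(1) _ Q'(3) in_nbhd(2) _ R(1) _ _ _ _ _ _ _ _ size'])
    show "c \<in> nbhd E u" "c \<in> nbhd E v" using c nbhd_u nbhd_v by auto
    show "P \<union> P' \<subseteq> E" "Q \<union> Q' \<subseteq> E" using P(1) P'(1) Q(1) Q'(1) by auto
    show "(P \<union> P') \<inter> (Q \<union> Q') = {}"
      using PQ P(3) Q(3) P'(4,5) Q'(4,5) aC bC fresh by fastforce
    show "\<Union>R \<inter> {u, v} = {}" using R(2) fresh by auto
    show "S_edges R \<inter> (P \<union> P' \<union> (Q \<union> Q')) = {}"
      using R(3) SR P'(4) Q'(4) aC bC by blast
    show "finite (F \<union> P' \<union> Q')" "finite (W \<union> Wa)" "finite (W \<union> Wb)"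
      using F(1) W P'(2,6) Q'(2,6) by auto
    show "P \<union> P' \<union> (Q \<union> Q') \<union> S_edges R \<subseteq> F \<union> P' \<union> Q'" using F(2) by auto
    have "insert a C - (W \<union> Wa) = nbhd E u - {v} - (W \<union> Wa)" "insert b C - (W \<union> Wb) = nbhd E v - {u} - (W \<union> Wb)"
      using C_u C_v by simp_all
    then show "E \<inter> nsets (nbhd E u - {v} - (W \<union> Wa)) 2 \<subseteq> F \<union> P' \<union> Q'"
      "E \<inter> nsets (nbhd E v - {u} - (W \<union> Wb)) 2 \<subseteq> F \<union> P' \<union> Q'"
      using cover1[OF P'(8,9)] cover1[OF Q'(8,9)] by auto
  qed
qed

section \<open>No two disjoint edges on \<open>C\<close>: one edge, star, triangle\<close>

text \<open>If \<open>c\<close> and the matching avoid \<open>s\<close>, the zero-price condition of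
  \<open>reducible_coreI\<close> holds. When \<open>W\<close> already contains all neighbours of
  \<open>x\<close> in \<open>C\<close>, \<open>s\<close> is an arbitrary vertex of
  \<open>C\<close>.\<close>

lemma nbr_choice:
  obtains s where "s \<in> C" "nbhd E x \<inter> C \<subseteq> W \<or> s \<in> nbhd E x - W"
proof (cases "nbhd E x \<inter> C \<subseteq> W")
  case True
  obtain s where "s \<in> C" by (rule other_vertex[of "[]"]) auto
  then show thesis using True that[of s] by blast
next
  case False
  then obtain s where "s \<in> C" "s \<in> nbhd E x" "s \<notin> W" by blast
  then show thesis using that[of s] by blast
qed

text \<open>The triangle \<open>uvc\<close> pays for \<open>uv\<close> and \<open>e\<close>, and
  \<open>c\<close> is chosen so that \<open>a\<close> and \<open>b\<close> are free.\<close>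

lemma reducible_if_le_one_edge:
  assumes "E \<inter> nsets C 2 \<subseteq> {e}"
  shows "reducible V E {u, v}"
proof -
  obtain s where s: "s \<in> C" "nbhd E a \<inter> C \<subseteq> {} \<or> s \<in> nbhd E a - {}" by (rule nbr_choice)
  obtain t where t: "t \<in> C" "nbhd E b \<inter> C \<subseteq> {} \<or> t \<in> nbhd E b - {}" by (rule nbr_choice)
  obtain c where c: "c \<in> C" "c \<notin> set [s, t]" by (rule other_vertex[of "[s, t]"]) auto
  show ?thesis
  proof (rule reducible_coreI[of c "{}" "{}" "{}" "{}" "{e}" 0 0])
    show "E \<inter> nsets (C - {}) 2 \<subseteq> {e}" using assms by simp
  qed (use s t c in \<open>auto simp: triangle_packing_def S_edges_def\<close>)
qed

text \<open>Deleting the edges from \<open>u\<close> and \<open>v\<close> to the centre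
  \<open>s\<close> hits every edge on \<open>C\<close>. One star edge serves as matching for
  \<open>u\<close>; the budget is 1 + 2 + 1 against 2 * 2.\<close>

lemma reducible_star:
  assumes "s \<in> C" "x \<in> C" "y \<in> C" "x \<noteq> y" "{s, x} \<in> E" "{s, y} \<in> E"
    and star: "\<And>e. e \<in> E \<inter> nsets C 2 \<Longrightarrow> s \<in> e"
  shows "reducible V E {u, v}"
proof -
  obtain a1 where a1: "a1 \<in> C" "nbhd E a \<inter> C \<subseteq> {s} \<or> a1 \<in> nbhd E a - {s}" by (rule nbr_choice)
  obtain b1 where b1: "b1 \<in> C" "nbhd E b \<inter> C \<subseteq> {s} \<or> b1 \<in> nbhd E b - {s}" by (rule nbr_choice)
  \<comment> \<open>Of the two leaves \<open>x\<close> and \<open>y\<close>, one differs from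
    \<open>a1\<close>, which thus stays unmatched.\<close>
  obtain z where z: "z \<in> C" "{s, z} \<in> E" "z \<noteq> a1" using assms by metis
  obtain c where c: "c \<in> C" "c \<notin> set [s, z, a1, b1]"
    by (rule other_vertex[of "[s, z, a1, b1]"]) auto
  show ?thesis
  proof (rule reducible_coreI[of c "{s}" "{{s, z}}" "{}" "{}" "{{s, z}}" 0 0])
    show "E \<inter> nsets (C - {s}) 2 \<subseteq> {{s, z}}"
      using star by (fastforce simp: nsets_def)
  qed (use a1 b1 z c assms(1) in \<open>auto simp: triangle_packing_def S_edges_def\<close>)
qed

lemma reducible_if_triangle:
  assumes "{x, y, z} \<subseteq> C" "{x, y} \<in> E" "{x, z} \<in> E" "{y, z} \<in> E"
    and only: "\<And>e. e \<in> E \<inter> nsets C 2 \<Longrightarrow> e \<subseteq> {x, y, z}"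
  shows "reducible V E {u, v}"
proof -
  have ne: "x \<noteq> y" "x \<noteq> z" "y \<noteq> z" using assms(2-4) edge_in_graph(3)[OF graph] by blast+
  obtain a1 where a1: "a1 \<in> C" "nbhd E a \<inter> C \<subseteq> {} \<or> a1 \<in> nbhd E a - {}" by (rule nbr_choice)
  obtain b1 where b1: "b1 \<in> C" "nbhd E b \<inter> C \<subseteq> {} \<or> b1 \<in> nbhd E b - {}" by (rule nbr_choice)
  \<comment> \<open>Every vertex is missed by some edge of the triangle. Matching that edge at
    \<open>u\<close> leaves \<open>a1\<close> free, with budget 1 + 3 against 2 * 2.\<close>
  obtain s t where st: "{s, t} \<in> {{x, y}, {x, z}, {y, z}}" "a1 \<notin> {s, t}" "s \<in> C" "t \<in> C"
  proof -
    consider "a1 \<notin> {y, z}" | "a1 \<notin> {x, z}" | "a1 \<notin> {x, y}" using ne by auto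
    then show thesis
    proof cases
      case 1 then show ?thesis using that[of y z] assms(1) by simp
    next
      case 2 then show ?thesis using that[of x z] assms(1) by simp
    next
      case 3 then show ?thesis using that[of x y] assms(1) by simp
    qed
  qed
  obtain c where c: "c \<in> C" "c \<notin> set [s, t, a1, b1]"
    by (rule other_vertex[of "[s, t, a1, b1]"]) auto
  define F where "F = {{x, y}, {x, z}, {y, z}}"
  have "E \<inter> nsets C 2 \<subseteq> nsets {x, y, z} 2"
    using only by (fastforce simp: nsets_def)
  then have cover: "E \<inter> nsets C 2 \<subseteq> F"
    using ne by (simp add: nsets_triple F_def)
  have F: "finite F" "card F \<le> 3" "{s, t} \<in> F" "{s, t} \<in> E"
    using assms(2-4) st(1) by (auto simp: F_def card_insert_if)
  show ?thesis
  proof (rule reducible_coreI[of c "{}" "{{s, t}}" "{}" "{}" F 0 0])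
    show "E \<inter> nsets (C - {}) 2 \<subseteq> F" using cover by simp
  qed (use a1 b1 c st(2-4) F in \<open>auto simp: triangle_packing_def S_edges_def\<close>)
qed

section \<open>Two disjoint edges on \<open>C\<close>: the explicit configurations\<close>

lemmas packing_simps = triangle_packing_def S_edges_def doubleton_eq_iff pairwise_insert

text \<open>The candidate edges to be covered for \<open>W = {c}\<close> and \<open>W = {}\<close>;
  \<open>C - {}\<close> is left unsimplified to match the goal from
  \<open>reducible_coreI\<close>.\<close>

lemma edges_on_C:
  assumes "C = {c, x, y, z, w}" "distinct [c, x, y, z, w]"
  shows "nsets (C - {c}) 2 = {{x, y}, {x, z}, {x, w}, {y, z}, {y, w}, {z, w}}"
    and "nsets (C - {}) 2 = {{c, x}, {c, y}, {c, z}, {c, w},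
           {x, y}, {x, z}, {x, w}, {y, z}, {y, w}, {z, w}}"
  using assms distinct_5[OF assms(2)] by (simp_all add: nsets_2_insert insert_commute)

text \<open>One edge is matched at \<open>u\<close>, the other at \<open>v\<close>. A neighbour of
  \<open>a\<close> other than \<open>c\<close> misses one of the two edges, so giving that edge to
  \<open>u\<close> makes \<open>a\<close> free. Only \<open>b\<close> is paid for: 1 + 2 + 2 + 1
  against 2 * 3.\<close>

lemma reducible_2K2:
  assumes C: "C = {c, x, y, z, w}" and ne: "distinct [c, x, y, z, w]"
    and adj: "{x, y} \<in> E" "{z, w} \<in> E"
    and nonadj: "{x, z} \<notin> E" "{x, w} \<notin> E" "{y, z} \<notin> E" "{y, w} \<notin> E"
  shows "reducible V E {u, v}"
proof -
  note dist = distinct_5[OF ne]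
  have cover: "E \<inter> nsets (C - {c}) 2 \<subseteq> {{x, y}, {z, w}}"
    unfolding edges_on_C[OF C ne] using nonadj by (simp add: Int_insert_subset_iff)
  have main: "reducible V E {u, v}"
    if "e \<in> {{x, y}, {z, w}}" "f \<in> {{x, y}, {z, w}}" "e \<noteq> f"
      "nbhd E a \<inter> C \<subseteq> {c} \<or> \<not> nbhd E a \<inter> C \<subseteq> insert c e" for e f
  proof (rule reducible_coreI[of c "{c}" "{e}" "{f}" "{}" "{{x, y}, {z, w}}" 0 1])
    show "E \<inter> nsets (C - {c}) 2 \<subseteq> {{x, y}, {z, w}}" by (rule cover)
  qed (use C dist adj that in \<open>auto simp: triangle_packing_def S_edges_def card_insert_if\<close>)
  have "{x, y} \<noteq> {z, w}" using dist by (simp add: doubleton_eq_iff)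
  note main1 = main[of "{x, y}" "{z, w}", simplified, OF this]
    and main2 = main[of "{z, w}" "{x, y}", simplified, OF this[symmetric]]
  have "nbhd E a \<inter> C \<subseteq> {c} \<or> \<not> nbhd E a \<inter> C \<subseteq> {c, x, y} \<or> \<not> nbhd E a \<inter> C \<subseteq> {c, z, w}"
    using dist by blast
  then show ?thesis
    using main1 main2 by argo
qed

text \<open>The end edges go to \<open>u\<close> and the middle edge to \<open>v\<close>. The budget
  1 + 2 + 3 + 1 + 1 against 2 * 4 even pays for both \<open>a\<close> and \<open>b\<close>.\<close>

lemma reducible_P4:
  assumes C: "C = {c, x, y, z, w}" and ne: "distinct [c, x, y, z, w]"
    and adj: "{x, y} \<in> E" "{y, z} \<in> E" "{z, w} \<in> E"
    and nonadj: "{x, z} \<notin> E" "{x, w} \<notin> E" "{y, w} \<notin> E"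
  shows "reducible V E {u, v}"
proof (rule reducible_coreI[of c "{c}" "{{x, y}, {z, w}}" "{{y, z}}" "{}" "{{x, y}, {z, w}, {y, z}}" 1 1])
  show "E \<inter> nsets (C - {c}) 2 \<subseteq> {{x, y}, {z, w}, {y, z}}"
    unfolding edges_on_C[OF C ne] using nonadj by (simp add: Int_insert_subset_iff)
qed (use C distinct_5[OF ne] adj in \<open>simp_all add: packing_simps\<close>)

text \<open>The paw is the triangle \<open>xyz\<close> with pendant edge \<open>zw\<close>. Matching
  \<open>xz\<close> or \<open>yz\<close> at \<open>u\<close> makes \<open>a\<close> free, unless
  \<open>z\<close> is its only neighbour in \<open>C\<close> apart from possibly \<open>c\<close>;
  then both choices fail.\<close>

lemma reducible_paw_if_nbrs_neq:
  assumes C: "C = {c, x, y, z, w}" and ne: "distinct [c, x, y, z, w]"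
    and adj: "{x, y} \<in> E" "{z, w} \<in> E" "{x, z} \<in> E" "{y, z} \<in> E"
    and nonadj: "{x, w} \<notin> E" "{y, w} \<notin> E"
    and a: "nbhd E a \<inter> C - {c} \<noteq> {z}"
  shows "reducible V E {u, v}"
proof -
  note dist = distinct_5[OF ne]
  let ?F = "{{x, y}, {z, w}, {x, z}, {y, z}}"
  have cover: "E \<inter> nsets (C - {c}) 2 \<subseteq> ?F"
    unfolding edges_on_C[OF C ne] using nonadj by (simp add: Int_insert_subset_iff)
  have main: "reducible V E {u, v}"
    if "s \<in> {x, y}" "nbhd E a \<inter> C \<subseteq> {c} \<or> \<not> nbhd E a \<inter> C \<subseteq> {c, s, z}" for s
  proof -
    have s: "s \<in> C" "{s, z} \<in> E" "s \<noteq> c" "s \<noteq> z" "s \<noteq> w" "z \<noteq> s" "w \<noteq> s" "c \<noteq> s"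
      "{s, z} \<noteq> {x, y}" "{s, z} \<in> ?F"
      using that(1) C dist adj by (elim insertE; simp add: doubleton_eq_iff)+
    show ?thesis
    proof (rule reducible_coreI[of c "{c}" "{{s, z}}" "{{x, y}, {z, w}}" "{}" ?F 0 1])
      show "E \<inter> nsets (C - {c}) 2 \<subseteq> ?F" by (rule cover)
    qed (use C dist adj s that(2) in \<open>simp_all add: packing_simps\<close>)
  qed
  have N: "nbhd E a \<inter> C \<subseteq> {c} \<or> \<not> nbhd E a \<inter> C \<subseteq> {c, x, z} \<or> \<not> nbhd E a \<inter> C \<subseteq> {c, y, z}"
    using a dist by blast
  show ?thesis
    using main[of x, simplified] main[of y, simplified] N by argo
qed

lemma reducible_paw:
  assumes C: "C = {c, x, y, z, w}" and ne: "distinct [c, x, y, z, w]"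
    and adj: "{x, y} \<in> E" "{z, w} \<in> E" "{x, z} \<in> E" "{y, z} \<in> E"
    and nonadj: "{x, w} \<notin> E" "{y, w} \<notin> E"
  shows "reducible V E {u, v}"
proof -
  note dist = distinct_5[OF ne]
  interpret swapped: five_common_nbrs V E v u b a C by (rule swap)
  show ?thesis
  proof (cases "nbhd E a \<inter> C - {c} = {z} \<and> nbhd E b \<inter> C - {c} = {z}")
    case False
    then consider "nbhd E a \<inter> C - {c} \<noteq> {z}" | "nbhd E b \<inter> C - {c} \<noteq> {z}" by blast
    then show ?thesis
    proof cases
      case 1
      then show ?thesis by (rule reducible_paw_if_nbrs_neq[OF assms])
    next
      case 2
      then have "reducible V E {v, u}" by (rule swapped.reducible_paw_if_nbrs_neq[OF assms])
      then show ?thesis by (simp only: insert_commute)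
    qed
  next
    \<comment> \<open>Here \<open>a\<close> and \<open>b\<close> see only \<open>z\<close> in
      \<open>C\<close> apart from possibly \<open>c\<close>. Deleting the edges from
      \<open>u\<close> and \<open>v\<close> to both \<open>c\<close> and \<open>z\<close> leaves
      \<open>xy\<close> as the only edge in either link.\<close>
    case True
    then have Na: "nbhd E a \<inter> C - {c} = {z}" and Nb: "nbhd E b \<inter> C - {c} = {z}" by blast+
    have "z \<in> nbhd E a" using Na by blast
    moreover have "p \<notin> nbhd E a" "p \<notin> nbhd E b" if "p \<in> C" "p \<noteq> c" "p \<noteq> z" for p
      using that Na Nb by blast+
    ultimately have az: "{a, z} \<in> E"
      and ab: "{a, x} \<notin> E" "{a, y} \<notin> E" "{a, w} \<notin> E" "{b, x} \<notin> E" "{b, y} \<notin> E" "{b, w} \<notin> E"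
      using C dist by (simp_all add: nbhd_def)
    have nbhds: "nsets (nbhd E u - {v} - {c, z}) 2 = {{a, x}, {a, y}, {a, w}, {x, y}, {x, w}, {y, w}}"
      "nsets (nbhd E v - {u} - {c, z}) 2 = {{b, x}, {b, y}, {b, w}, {x, y}, {x, w}, {y, w}}"
    proof -
      have "nbhd E u - {v} - {c, z} = {a, x, y, w}" "nbhd E v - {u} - {c, z} = {b, x, y, w}"
        using fresh C dist unfolding nbhd_u nbhd_v by auto
      moreover have "a \<notin> {x, y, w}" "b \<notin> {x, y, w}" using fresh C by auto
      ultimately show "nsets (nbhd E u - {v} - {c, z}) 2 = {{a, x}, {a, y}, {a, w}, {x, y}, {x, w}, {y, w}}"
        "nsets (nbhd E v - {u} - {c, z}) 2 = {{b, x}, {b, y}, {b, w}, {x, y}, {x, w}, {y, w}}"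
        using dist by (simp_all add: nsets_2_insert insert_commute)
    qed
    have ab_neq: "u \<noteq> v" "v \<noteq> u" "u \<noteq> a" "a \<noteq> u" "u \<noteq> b" "b \<noteq> u"
      "u \<noteq> c" "c \<noteq> u" "u \<noteq> x" "x \<noteq> u" "u \<noteq> y" "y \<noteq> u"
      "u \<noteq> z" "z \<noteq> u" "u \<noteq> w" "w \<noteq> u" "v \<noteq> a" "a \<noteq> v"
      "v \<noteq> b" "b \<noteq> v" "v \<noteq> c" "c \<noteq> v" "v \<noteq> x" "x \<noteq> v"
      "v \<noteq> y" "y \<noteq> v" "v \<noteq> z" "z \<noteq> v" "v \<noteq> w" "w \<noteq> v"
      "a \<noteq> b" "b \<noteq> a" "a \<noteq> c" "c \<noteq> a" "a \<noteq> x" "x \<noteq> a"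
      "a \<noteq> y" "y \<noteq> a" "a \<noteq> z" "z \<noteq> a" "a \<noteq> w" "w \<noteq> a"
      "b \<noteq> c" "c \<noteq> b" "b \<noteq> x" "x \<noteq> b" "b \<noteq> y" "y \<noteq> b"
      "b \<noteq> z" "z \<noteq> b" "b \<noteq> w" "w \<noteq> b"
      using fresh C by auto
    txt \<open>The edge \<open>az\<close> is used although \<open>uz\<close> is deleted anyway, so \<open>ua\<close> may stay.\<close>
    let ?F = "{{x, y}, {a, z}, {z, w}}"
    show ?thesis
    proof (rule reducible_edgeI[OF graph uv, of c "{{x, y}, {a, z}}" "{{z, w}}" "{}" ?F "{c, z}" "{c, z}"])
      show "E \<inter> nsets (nbhd E u - {v} - {c, z}) 2 \<subseteq> ?F" "E \<inter> nsets (nbhd E v - {u} - {c, z}) 2 \<subseteq> ?F"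
        unfolding nbhds using nonadj ab by (simp_all add: Int_insert_subset_iff)
    qed (use C dist adj az ab_neq in \<open>simp_all add: nbhd_u nbhd_v packing_simps\<close>)
  qed
qed

text \<open>The 4-cycle splits into two perfect matchings, one for each of \<open>u\<close> and
  \<open>v\<close>. Listing \<open>yw\<close> in \<open>F\<close> also covers K4 minus an edge: 1 +
  2 + 5 + 1 + 1 against 2 * 5.\<close>

lemma reducible_C4:
  assumes C: "C = {c, x, y, z, w}" and ne: "distinct [c, x, y, z, w]"
    and adj: "{x, y} \<in> E" "{y, z} \<in> E" "{z, w} \<in> E" "{x, w} \<in> E"
    and nonadj: "{x, z} \<notin> E"
  shows "reducible V E {u, v}"
proof (rule reducible_coreI[of c "{c}" "{{x, y}, {z, w}}" "{{y, z}, {x, w}}" "{}"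
      "{{x, y}, {z, w}, {y, z}, {x, w}, {y, w}}" 1 1])
  show "E \<inter> nsets (C - {c}) 2 \<subseteq> {{x, y}, {z, w}, {y, z}, {x, w}, {y, w}}"
    unfolding edges_on_C[OF C ne] using nonadj by (simp add: Int_insert_subset_iff)
qed (use C distinct_5[OF ne] adj in \<open>simp_all add: packing_simps\<close>)

text \<open>With all six edges of the K4 in \<open>F\<close>, the choice \<open>W = {c}\<close>
  would exceed the budget by one. Taking \<open>W = {}\<close> and deleting the at most one edge at
  \<open>c\<close> costs 1 + 7 + 1 + 1 against 2 * 5.\<close>

lemma reducible_K4_degree_le_1:
  assumes C: "C = {c, x, y, z, w}" and ne: "distinct [c, x, y, z, w]"
    and adj: "{x, y} \<in> E" "{x, z} \<in> E" "{x, w} \<in> E" "{y, z} \<in> E" "{y, w} \<in> E" "{z, w} \<in> E"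
    and nonadj: "{c, x} \<notin> E" "{c, y} \<notin> E" "{c, z} \<notin> E"
  shows "reducible V E {u, v}"
proof (rule reducible_coreI[of c "{}" "{{x, y}, {z, w}}" "{{y, z}, {x, w}}" "{}"
      "{{x, y}, {z, w}, {y, z}, {x, w}, {x, z}, {y, w}, {c, w}}" 1 1])
  show "E \<inter> nsets (C - {}) 2 \<subseteq> {{x, y}, {z, w}, {y, z}, {x, w}, {x, z}, {y, w}, {c, w}}"
    unfolding edges_on_C[OF C ne] using nonadj by (simp add: Int_insert_subset_iff)
qed (use C distinct_5[OF ne] adj in \<open>simp_all add: packing_simps\<close>)

text \<open>Two perfect matchings of the K4 are used at \<open>u\<close> and \<open>v\<close>. The
  edge \<open>xy\<close> of the third one is left for the extra triangle \<open>cxy\<close>, which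
  pays for two further edges at \<open>c\<close>.\<close>

lemma reducible_K4_degree_2_or_3:
  assumes C: "C = {c, x, y, z, w}" and ne: "distinct [c, x, y, z, w]"
    and adj: "{x, y} \<in> E" "{x, z} \<in> E" "{x, w} \<in> E" "{y, z} \<in> E" "{y, w} \<in> E" "{z, w} \<in> E"
      "{c, x} \<in> E" "{c, y} \<in> E"
    and nonadj: "{c, z} \<notin> E"
  shows "reducible V E {u, v}"
proof -
  note dist = distinct_5[OF ne]
  let ?F = "{{x, y}, {z, w}, {y, z}, {x, w}, {x, z}, {y, w}, {c, w}, {c, x}, {c, y}}"
  have "c \<noteq> x" "c \<noteq> y" "x \<noteq> y" using C dist by auto
  then have S: "S_edges {{c, x, y}} = {{c, x}, {c, y}, {x, y}}"
    by (simp add: S_edges_def nsets_triple)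
  show ?thesis
  proof (rule reducible_coreI[of c "{}" "{{x, z}, {y, w}}" "{{x, w}, {y, z}}" "{{c, x, y}}" ?F 1 1])
    show "E \<inter> nsets (C - {}) 2 \<subseteq> ?F"
    unfolding edges_on_C[OF C ne] using nonadj by (simp add: Int_insert_subset_iff)
    show "triangle_packing V E {{c, x, y}}"
      using triangleI[OF graph adj(7,8,1)] by (simp add: triangle_packing_def)
  qed (unfold S, use C dist adj in \<open>simp_all add: packing_simps\<close>)
qed

text \<open>Both edges of the third perfect matching now form triangles with \<open>c\<close>: 1 +
  10 + 1 + 1 against 2 * 7.\<close>

lemma reducible_K5:
  assumes C: "C = {c, x, y, z, w}" and ne: "distinct [c, x, y, z, w]"
    and adj: "{x, y} \<in> E" "{x, z} \<in> E" "{x, w} \<in> E" "{y, z} \<in> E" "{y, w} \<in> E" "{z, w} \<in> E"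
      "{c, x} \<in> E" "{c, y} \<in> E" "{c, z} \<in> E" "{c, w} \<in> E"
  shows "reducible V E {u, v}"
proof -
  note dist = distinct_5[OF ne]
  let ?F = "{{x, y}, {z, w}, {y, z}, {x, w}, {x, z}, {y, w}, {c, w}, {c, x}, {c, y}, {c, z}}"
  have S: "S_edges {{c, x, y}, {c, z, w}} = {{c, x}, {c, y}, {x, y}, {c, z}, {c, w}, {z, w}}"
    using dist by (simp add: S_edges_def nsets_triple insert_commute)
  show ?thesis
  proof (rule reducible_coreI[of c "{}" "{{x, z}, {y, w}}" "{{x, w}, {y, z}}" "{{c, x, y}, {c, z, w}}" ?F 1 1])
    show "E \<inter> nsets (C - {}) 2 \<subseteq> ?F"
      unfolding edges_on_C[OF C ne] by (simp add: Int_insert_subset_iff)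
    show "triangle_packing V E {{c, x, y}, {c, z, w}}"
      using triangleI[OF graph adj(7,8,1)] triangleI[OF graph adj(9,10,6)] C ne
      by (auto simp: triangle_packing_def pairwise_insert nsets_triple doubleton_eq_iff)
    have "{c, x, y} \<noteq> {c, z, w}" using C dist by auto
    then show "1 + 2 * card {} + card ?F + 1 + 1 \<le> 2 * (1 + card {{x, z}, {y, w}} + card {{x, w}, {y, z}} + card {{c, x, y}, {c, z, w}})"
      using C dist by (simp add: doubleton_eq_iff)
  qed (unfold S, use C dist adj in \<open>simp_all add: packing_simps\<close>)
qed

section \<open>Case analysis on the graph induced on \<open>C\<close>\<close>

lemma C_eqI:
  assumes "distinct [c, x, y, z, w]" "{c, x, y, z, w} \<subseteq> C"
  shows "C = {c, x, y, z, w}"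
proof -
  have "card (set [c, x, y, z, w]) = 5"
    using assms(1) by (simp only: distinct_card) simp
  moreover have "finite C" using card_C card.infinite by fastforce
  ultimately show ?thesis
    using card_subset_eq[OF _ assms(2)] card_C by simp
qed

lemma reducible_K4:
  assumes c: "c \<in> C"
    and complete: "\<And>p q. p \<in> C - {c} \<Longrightarrow> q \<in> C - {c} \<Longrightarrow> p \<noteq> q \<Longrightarrow> {p, q} \<in> E"
  shows "reducible V E {u, v}"
proof -
  have deg_2_or_3: "reducible V E {u, v}"
    if "{p, q, r} \<subseteq> C - {c}" "distinct [p, q, r]" "{c, p} \<in> E" "{c, q} \<in> E" "{c, r} \<notin> E" for p q r
  proof -
    obtain s where s: "s \<in> C" "s \<notin> set [c, p, q, r]" by (rule other_vertex[of "[c, p, q, r]"]) auto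
    have ne: "distinct [c, p, q, r, s]" using that s by auto
    have C_eq: "C = {c, p, q, r, s}" by (rule C_eqI[OF ne]) (use that s c in auto)
    show ?thesis
      by (rule reducible_K4_degree_2_or_3[OF C_eq ne]) (use that s complete in auto)
  qed
  have deg_le_1: "reducible V E {u, v}"
    if "{p, q, r} \<subseteq> C - {c}" "distinct [p, q, r]" "{c, p} \<notin> E" "{c, q} \<notin> E" "{c, r} \<notin> E" for p q r
  proof -
    obtain s where s: "s \<in> C" "s \<notin> set [c, p, q, r]" by (rule other_vertex[of "[c, p, q, r]"]) auto
    have ne: "distinct [c, p, q, r, s]" using that s by auto
    have C_eq: "C = {c, p, q, r, s}" by (rule C_eqI[OF ne]) (use that s c in auto)
    show ?thesis
      by (rule reducible_K4_degree_le_1[OF C_eq ne]) (use that s complete in auto)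
  qed
  \<comment> \<open>\<open>r\<close> is a non-neighbour of \<open>c\<close> if one exists in
    \<open>C - {c}\<close>, and arbitrary otherwise.\<close>
  obtain r where r: "r \<in> C" "r \<noteq> c" "(\<forall>p \<in> C - {c}. {c, p} \<in> E) \<or> {c, r} \<notin> E"
  proof (cases "\<forall>p \<in> C - {c}. {c, p} \<in> E")
    case True
    obtain r where "r \<in> C" "r \<notin> set [c]" by (rule other_vertex[of "[c]"]) auto
    then show thesis using that[of r] True by auto
  next
    case False
    then show thesis using that by blast
  qed
  obtain x where x: "x \<in> C" "x \<notin> set [c, r]" by (rule other_vertex[of "[c, r]"]) auto
  obtain y where y: "y \<in> C" "y \<notin> set [c, r, x]" by (rule other_vertex[of "[c, r, x]"]) auto
  obtain z where z: "z \<in> C" "z \<notin> set [c, r, x, y]" by (rule other_vertex[of "[c, r, x, y]"]) auto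
  note rxyz = r(1,2) x y z
  show ?thesis
  proof (cases "\<forall>p \<in> C - {c}. {c, p} \<in> E")
    case True
    have ne: "distinct [c, r, x, y, z]" using rxyz by auto
    have C_eq: "C = {c, r, x, y, z}" by (rule C_eqI[OF ne]) (use rxyz c in auto)
    show ?thesis
      by (rule reducible_K5[OF C_eq ne]) (use rxyz True complete in auto)
  next
    case False
    then have nr: "{c, r} \<notin> E" using r by blast
    \<comment> \<open>Two of the three vertices \<open>x\<close>, \<open>y\<close>, \<open>z\<close>
      agree on adjacency to \<open>c\<close>.\<close>
    consider "{c, x} \<in> E" "{c, y} \<in> E" | "{c, x} \<in> E" "{c, z} \<in> E" | "{c, y} \<in> E" "{c, z} \<in> E"
      | "{c, x} \<notin> E" "{c, y} \<notin> E" | "{c, x} \<notin> E" "{c, z} \<notin> E" | "{c, y} \<notin> E" "{c, z} \<notin> E"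
      by blast
    then show ?thesis
    proof cases
      case 1 then show ?thesis by (rule deg_2_or_3[of x y r, rotated 2]) (use rxyz nr in auto)
    next
      case 2 then show ?thesis by (rule deg_2_or_3[of x z r, rotated 2]) (use rxyz nr in auto)
    next
      case 3 then show ?thesis by (rule deg_2_or_3[of y z r, rotated 2]) (use rxyz nr in auto)
    next
      case 4 then show ?thesis by (rule deg_le_1[of x y r, rotated 2]) (use rxyz nr in auto)
    next
      case 5 then show ?thesis by (rule deg_le_1[of x z r, rotated 2]) (use rxyz nr in auto)
    next
      case 6 then show ?thesis by (rule deg_le_1[of y z r, rotated 2]) (use rxyz nr in auto)
    qed
  qed
qed

text \<open>The four possible edges between \<open>xy\<close> and \<open>zw\<close> give sixteen
  patterns. None gives 2K2, one a path, two with a common vertex a paw, two disjoint ones or three a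
  4-cycle missing a diagonal, and all four K4. The relabelled instances below realise these
  patterns.\<close>

lemma reducible_if_disjoint_edges:
  assumes C: "C = {c, x, y, z, w}" and ne: "distinct [c, x, y, z, w]"
    and adj: "{x, y} \<in> E" "{z, w} \<in> E"
  shows "reducible V E {u, v}"
proof -
  \<comment> \<open>One orientation per edge, so that \<open>sat\<close> sees a single atom for
    it.\<close>
  have sym: "{y, x} = {x, y}" "{z, x} = {x, z}" "{w, x} = {x, w}" "{z, y} = {y, z}"
    "{w, y} = {y, w}" "{w, z} = {z, w}"
    by auto
  have perm: "C = {c, x, y, w, z}" "C = {c, y, x, z, w}" "C = {c, y, x, w, z}" "C = {c, z, w, x, y}"
    "C = {c, z, w, y, x}" "C = {c, y, z, w, x}" "C = {c, y, w, z, x}"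
    using C by auto
  have dist: "distinct [c, x, y, w, z]" "distinct [c, y, x, z, w]" "distinct [c, y, x, w, z]"
    "distinct [c, z, w, x, y]" "distinct [c, z, w, y, x]" "distinct [c, y, z, w, x]" "distinct [c, y, w, z, x]"
    using ne by auto
  note paths = reducible_P4[OF C ne] reducible_P4[OF perm(1) dist(1)] reducible_P4[OF perm(2) dist(2)] reducible_P4[OF perm(3) dist(3)]
  note paws = reducible_paw[OF C ne] reducible_paw[OF perm(1) dist(1)] reducible_paw[OF perm(4) dist(4)] reducible_paw[OF perm(5) dist(5)]
  note cycles = reducible_C4[OF C ne] reducible_C4[OF perm(6) dist(6)] reducible_C4[OF perm(1) dist(1)] reducible_C4[OF perm(7) dist(7)]
  have K4: "reducible V E {u, v}" if "{x, z} \<in> E" "{x, w} \<in> E" "{y, z} \<in> E" "{y, w} \<in> E"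
  proof (rule reducible_K4[of c])
    fix p q assume "p \<in> C - {c}" "q \<in> C - {c}" "p \<noteq> q"
    then have "p \<in> {x, y, z, w}" "q \<in> {x, y, z, w}" "p \<noteq> q" using C by blast+
    then show "{p, q} \<in> E"
      using that adj by (elim insertE emptyE) (simp_all add: sym)
  qed (use C in simp)
  show ?thesis
    using reducible_2K2[OF C ne] paths paws cycles K4 adj unfolding sym by sat
qed

lemma reducible_if_common_vertex:
  assumes "{s, t} \<in> E \<inter> nsets C 2" and centre: "\<And>e. e \<in> E \<inter> nsets C 2 \<Longrightarrow> s \<in> e"
  shows "reducible V E {u, v}"
proof (cases "E \<inter> nsets C 2 \<subseteq> {{s, t}}")
  case True
  then show ?thesis by (rule reducible_if_le_one_edge)
next
  case False
  then obtain e where e: "e \<in> E \<inter> nsets C 2" "e \<noteq> {s, t}" by blast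
  then obtain p q where "e = {p, q}" "p \<noteq> q" using edgeE[OF graph] by blast
  then obtain r where r: "e = {s, r}" using centre[OF e(1)] by auto
  show ?thesis
    by (rule reducible_star[of s t r]) (use assms e r in \<open>auto simp: nsets_def\<close>)
qed

text \<open>Fix an edge \<open>st\<close>. If neither end lies on all edges, an edge through
  \<open>t\<close> and one through \<open>s\<close> must meet in a third vertex \<open>p\<close>.
  Every edge meets all three sides of \<open>stp\<close>, hence lies inside it.\<close>

lemma reducible_if_intersecting:
  assumes inter: "\<And>e f. e \<in> E \<inter> nsets C 2 \<Longrightarrow> f \<in> E \<inter> nsets C 2 \<Longrightarrow> e \<inter> f \<noteq> {}"
  shows "reducible V E {u, v}"
proof (cases "E \<inter> nsets C 2 = {}")
  case True
  then show ?thesis using reducible_if_le_one_edge by blast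
next
  case False
  let ?H = "E \<inter> nsets C 2"
  have pair: "\<exists>p q. e = {p, q} \<and> p \<noteq> q" if "e \<in> ?H" for e
    using that edgeE[OF graph] by blast
  obtain s t where st: "{s, t} \<in> ?H" "s \<noteq> t" using False pair by blast
  consider "\<And>e. e \<in> ?H \<Longrightarrow> s \<in> e" | "\<And>e. e \<in> ?H \<Longrightarrow> t \<in> e"
    | e f where "e \<in> ?H" "s \<notin> e" "f \<in> ?H" "t \<notin> f"
    by blast
  then show ?thesis
  proof cases
    case 1
    then show ?thesis using reducible_if_common_vertex[of s t] st by blast
  next
    case 2
    then show ?thesis using reducible_if_common_vertex[of t s] st by (simp add: insert_commute)
  next
    case (3 e f)
    obtain p where p: "e = {t, p}" "p \<noteq> t" using pair[OF 3(1)] inter[OF 3(1) st(1)] 3(2) by auto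
    obtain q where q: "f = {s, q}" "q \<noteq> s" using pair[OF 3(3)] inter[OF 3(3) st(1)] 3(4) by auto
    have pq: "p = q" "p \<noteq> s" using inter[OF 3(1,3)] 3 p q st by auto
    show ?thesis
    proof (rule reducible_if_triangle[of s t p])
      show "{s, t, p} \<subseteq> C" using st 3 p by (auto simp: nsets_def)
      show "{s, t} \<in> E" "{s, p} \<in> E" "{t, p} \<in> E" using st 3 p q pq by auto
      fix g assume g: "g \<in> ?H"
      obtain m n where mn: "g = {m, n}" using pair[OF g] by blast
      show "g \<subseteq> {s, t, p}"
        using inter[OF g st(1)] inter[OF g 3(1)] inter[OF g 3(3)] mn p q pq st(2) by auto
    qed
  qed
qed

lemma reducible_uv: "reducible V E {u, v}"
proof (cases "\<forall>e \<in> E \<inter> nsets C 2. \<forall>f \<in> E \<inter> nsets C 2. e \<inter> f \<noteq> {}")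
  case True
  then show ?thesis by (intro reducible_if_intersecting) blast
next
  case False
  then obtain e f where ef: "e \<in> E" "e \<in> nsets C 2" "f \<in> E" "f \<in> nsets C 2" "e \<inter> f = {}" by blast
  obtain x y where xy: "e = {x, y}" "x \<noteq> y" using edgeE[OF graph ef(1)] .
  obtain z w where zw: "f = {z, w}" "z \<noteq> w" using edgeE[OF graph ef(3)] .
  obtain c where c: "c \<in> C" "c \<notin> set [x, y, z, w]" by (rule other_vertex[of "[x, y, z, w]"]) auto
  have ne: "distinct [c, x, y, z, w]" using ef xy zw c by auto
  have C_eq: "C = {c, x, y, z, w}"
    by (rule C_eqI[OF ne]) (use ef xy zw c in \<open>auto simp: nsets_def\<close>)
  show ?thesis
    by (rule reducible_if_disjoint_edges[OF C_eq ne]) (use ef xy zw in auto)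
qed

end

section \<open>From regularity to the local picture\<close>

theorem proposition8p5:
  fixes V :: "'a set" and E :: "'a set set" and u v :: 'a
  assumes "simple_graph V E"
    and "connected_graph V E"
    and "regular_graph 7 V E"
    and "\<tau> V E > 2 * \<nu> V E"
    and "{u, v} \<in> E"
    and "card (nbhd E u \<inter> nbhd E v) = 5"
  shows "reducible V E {u, v}"
proof -
  note edge = edge_in_graph[OF assms(1)]
  \<comment> \<open>Of the seven neighbours of \<open>x\<close>, five are common and one is
    \<open>y\<close>, which leaves exactly one.\<close>
  have extra_nbr: "\<exists>p. nbhd E x = insert y (insert p (nbhd E u \<inter> nbhd E v)) \<and>
      p \<notin> nbhd E u \<inter> nbhd E v \<and> p \<noteq> x \<and> p \<noteq> y"
    if xy: "{x, y} \<in> E" "nbhd E u \<inter> nbhd E v \<subseteq> nbhd E x" "y \<notin> nbhd E u \<inter> nbhd E v" for x y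
  proof -
    have "card (nbhd E x) = 7" using edge[OF xy(1)] assms(3) by (simp add: regular_graph_def)
    moreover have y: "y \<in> nbhd E x" using xy by (simp add: nbhd_def)
    moreover have fin: "finite (nbhd E x)" using calculation(1) card.infinite by fastforce
    ultimately have "card (nbhd E x - insert y (nbhd E u \<inter> nbhd E v)) = 1"
      using xy assms(6) finite_subset[OF xy(2) fin] by (subst card_Diff_subset) auto
    then obtain p where p: "nbhd E x - insert y (nbhd E u \<inter> nbhd E v) = {p}"
      by (auto simp: card_1_singleton_iff)
    moreover have "x \<notin> nbhd E x" using edge(3)[of x x] by (auto simp: nbhd_def)
    ultimately show ?thesis using y xy by (intro exI[of _ p]) blast
  qed
  have irr: "u \<notin> nbhd E u" "v \<notin> nbhd E v"
    using edge(3)[of u u] edge(3)[of v v] by (auto simp: nbhd_def)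
  have "{v, u} \<in> E" using assms(5) by (simp add: insert_commute)
  then obtain a b where
    a: "nbhd E u = insert v (insert a (nbhd E u \<inter> nbhd E v))" "a \<notin> nbhd E u \<inter> nbhd E v" "a \<noteq> u" "a \<noteq> v"
    and b: "nbhd E v = insert u (insert b (nbhd E u \<inter> nbhd E v))" "b \<notin> nbhd E u \<inter> nbhd E v" "b \<noteq> v" "b \<noteq> u"
    using extra_nbr[of u v] extra_nbr[of v u] assms(5) irr by auto
  have "a \<in> nbhd E u" "b \<in> nbhd E v" using a(1) b(1) by blast+
  then have "a \<noteq> b" using a(2) by blast
  then interpret five_common_nbrs V E u v a b "nbhd E u \<inter> nbhd E v"
    using assms a b irr edge(3)[OF assms(5)] by unfold_locales auto
  show ?thesis by (rule reducible_uv)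
qed

end
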